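(* Let $G_1,G_2$ be finite abelian groups with $|G_1|+1=|G_2|$. If $\varphi:G_1\to G_2$ is a circular Costas map, then $G_2$ is elementary abelian, i.e. $G_2\cong\mathbb{Z}_p^m$ for some prime $p$ and natural number $m$.
   Context: For finite abelian groups $G_1,G_2$ (written additively) with $|G_1|+1=|G_2|$, a map $\varphi:G_1\to G_2$ is circular Costas if $\varphi$ is injective and, for every $k\in G_1\setminus\{0\}$, the difference map $i\mapsto\varphi(i+k)-\varphi(i)$ from $G_1$ to $G_2$ is injective. *)

theory Defs
  imports "HOL-Algebra.Product_Groups" "HOL-Computational_Algebra.Primes"
begin

text \<open>The abelian groups are multiplicative in \<open>HOL-Algebra\<close>: the difference
  \<open>\<phi>(i + k) - \<phi>(i)\<close> reads \<open>\<phi> (i \<otimes> k) \<otimes> inv (\<phi> i)\<close>, and the condition \<open>k \<noteq> 0\<close> reads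
  \<open>k \<noteq> \<one>\<close>. The standing hypotheses on the two groups (finite, abelian,
  \<open>card (carrier G1) + 1 = card (carrier G2)\<close>) are not part of the predicate.\<close>

definition circular_costas ::
  "('a, 'c) monoid_scheme \<Rightarrow> ('b, 'd) monoid_scheme \<Rightarrow> ('a \<Rightarrow> 'b) \<Rightarrow> bool" where
  "circular_costas G1 G2 \<phi> \<longleftrightarrow>
     \<phi> \<in> carrier G1 \<rightarrow> carrier G2 \<and>
     inj_on \<phi> (carrier G1) \<and>
     (\<forall>k \<in> carrier G1 - {\<one>\<^bsub>G1\<^esub>}.
        inj_on (\<lambda>i. \<phi> (i \<otimes>\<^bsub>G1\<^esub> k) \<otimes>\<^bsub>G2\<^esub> inv\<^bsub>G2\<^esub> (\<phi> i)) (carrier G1))"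

text \<open>\<open>product_group {..<m} (\<lambda>_. integer_mod_group p)\<close> is the direct power
  \<open>(\<int>/p\<int>)\<^sup>m\<close> (trivial for \<open>m = 0\<close>).\<close>

definition elementary_abelian :: "('a, 'c) monoid_scheme \<Rightarrow> bool" where
  "elementary_abelian G \<longleftrightarrow>
     (\<exists>p m :: nat. Factorial_Ring.prime p \<and> G \<cong> product_group {..<m} (\<lambda>_. integer_mod_group p))"

end

theory Submission
  imports Defs "HOL-Number_Theory.Cong"
begin

text \<open>
  Translate \<open>\<phi>\<close> so that it misses exactly the identity, and let
  \<open>D \<subseteq> G = G1 \<times> G2\<close> be its graph. In the integral group ring of \<open>G\<close>, with \<open>D\<inverse>\<close> the
  sum of the inverses of the elements of \<open>D\<close> and \<open>n = |G2|\<close>, the circular Costas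
  property says \<open>D D\<inverse> = n + G - G1 - G2\<close>; moreover \<open>D G1 = G - G1\<close> and \<open>D G2 = G\<close>. For
  a prime \<open>p\<close> dividing \<open>n\<close> these relations give \<open>D\<^sup>p D\<inverse> = G - G1\<close> modulo \<open>p\<close>, while
  \<open>D\<^sup>p\<close> is congruent to \<open>\<Sum>d\<in>D. d\<^sup>p\<close>. So for every \<open>b \<noteq> 1\<close> in \<open>G2\<close> and every \<open>a \<in> G1\<close>
  some \<open>i\<close> satisfies \<open>\<phi>(i)\<^sup>p b = \<phi>(i\<^sup>p a)\<close>. For fixed \<open>b\<close> each \<open>i\<close> serves at most one \<open>a\<close>,
  so by pigeonhole every \<open>i\<close> occurs, and \<open>\<phi>(i)\<^sup>p b\<close>, being a value of \<open>\<phi>\<close>, is not the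
  identity. As \<open>b \<noteq> 1\<close> is arbitrary, \<open>\<phi>(i)\<^sup>p = 1\<close>, and \<open>G2\<close> has exponent \<open>p\<close>.
\<close>

section \<open>Counting fixed points modulo a prime\<close>

text \<open>Iterating \<open>f\<close> gives an action of the integers modulo \<open>p\<close>, so
  every orbit has one point or \<open>p\<close> points. The induction removes one orbit of size
  \<open>p\<close> at a time.\<close>

lemma card_fixpoints_cong_prime:
  fixes f :: "'a \<Rightarrow> 'a"
  assumes "Factorial_Ring.prime (p::nat)"
    and "finite S" and "f ` S \<subseteq> S" and "\<And>x. x \<in> S \<Longrightarrow> (f ^^ p) x = x"
  shows "[card S = card {x \<in> S. f x = x}] (mod p)"
  using assms(2-)
proof (induction S rule: finite_psubset_induct)
  case (psubset S)
  have p0: "p > 0" using assms(1) prime_gt_0_nat by blast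
  have iter_in: "(f ^^ i) x \<in> S" if "x \<in> S" for i x
    using that psubset.prems(1) by (induction i) auto
  show ?case
  proof (cases "\<forall>x\<in>S. f x = x")
    case True
    then have "{x \<in> S. f x = x} = S" by auto
    then show ?thesis by simp
  next
    case False
    then obtain x where x: "x \<in> S" "f x \<noteq> x" by blast
    have period: "(f ^^ (k * p)) y = y" if "y \<in> S" for k y
      using that psubset.prems(2) by (induction k) (auto simp: funpow_add)
    define Orb where "Orb = range (\<lambda>i. (f ^^ i) x)"
    have Orb_eq: "Orb = (\<lambda>i. (f ^^ i) x) ` {..<p}"
    proof -
      have mod: "(f ^^ i) x = (f ^^ (i mod p)) x" for i
      proof -
        have "(f ^^ i) x = (f ^^ (i mod p + i div p * p)) x" by simp
        also have "\<dots> = (f ^^ (i mod p)) x"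
          using period[OF x(1)] by (simp only: funpow_add o_apply)
        finally show ?thesis .
      qed
      have "(f ^^ i) x \<in> (\<lambda>i. (f ^^ i) x) ` {..<p}" for i
        by (rule image_eqI[of _ _ "i mod p"], rule mod) (simp add: p0)
      then show ?thesis unfolding Orb_def by blast
    qed
    \<comment> \<open>Bezout gives a multiple of \<open>d\<close> that is one more than a multiple
      of \<open>p\<close>; both multiples of steps fix \<open>x\<close>, so a single step does
      too.\<close>
    have fix_of_coprime: "f x = x" if d: "(f ^^ d) x = x" "coprime d p" "d \<noteq> 0" for d
    proof -
      have mult_d: "(f ^^ (a * d)) x = x" for a
        using d(1) by (induction a) (auto simp: funpow_add)
      obtain a b where "d * a = p * b + 1"
        using bezout_nat[OF d(3), of p] d(2) by auto
      then have "(f ^^ (a * d)) x = (f ^^ (1 + b * p)) x" by (simp add: mult.commute)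
      then show ?thesis
        using mult_d period[OF x(1)] by (simp add: funpow_add)
    qed
    have ne: "(f ^^ i) x \<noteq> (f ^^ j) x" if "i < j" "j < p" for i j
    proof
      assume eq: "(f ^^ i) x = (f ^^ j) x"
      \<comment> \<open>Another \<open>p - i\<close> steps complete the period on one side and leave
        the shift \<open>j - i\<close> on the other. It lies strictly between \<open>0\<close> and
        \<open>p\<close>, hence is coprime to \<open>p\<close>.\<close>
      have "x = (f ^^ (p - i + i)) x"
        using that psubset.prems(2)[OF x(1)] by simp
      also have "\<dots> = (f ^^ (p - i)) ((f ^^ j) x)"
        by (simp only: funpow_add o_apply eq)
      also have "\<dots> = (f ^^ (p - i + j)) x" by (simp only: funpow_add o_apply)
      also have "p - i + j = (j - i) + p" using that by simp
      also have "(f ^^ ((j - i) + p)) x = (f ^^ (j - i)) x"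
        using psubset.prems(2)[OF x(1)] by (simp only: funpow_add o_apply)
      finally have "(f ^^ (j - i)) x = x" by simp
      moreover have "coprime (j - i) p"
        using that prime_imp_coprime_nat[OF assms(1), of "j - i"] nat_dvd_not_less[of "j - i" p]
        by (simp add: coprime_commute)
      ultimately show False using fix_of_coprime[of "j - i"] that x(2) by simp
    qed
    have "inj_on (\<lambda>i. (f ^^ i) x) {..<p}"
      unfolding inj_on_def using ne by (metis lessThan_iff linorder_neqE_nat)
    then have card_Orb: "card Orb = p"
      unfolding Orb_eq by (simp add: card_image)
    have Orb_sub: "Orb \<subseteq> S" unfolding Orb_def using iter_in x(1) by auto
    \<comment> \<open>The iterate with exponent \<open>p - 1\<close> inverts \<open>f\<close>, so no
      point outside the orbit is mapped into it and the complement is closed under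
      \<open>f\<close>.\<close>
    have pre: "y \<in> Orb" if y: "y \<in> S" "f y \<in> Orb" for y
    proof -
      obtain i where i: "f y = (f ^^ i) x" using y(2) unfolding Orb_def by auto
      have "y = (f ^^ (p - 1 + 1)) y" using psubset.prems(2) y(1) p0 by simp
      also have "\<dots> = (f ^^ (p - 1 + i)) x" by (simp only: funpow_add o_apply) (simp add: i)
      finally show ?thesis unfolding Orb_def by blast
    qed
    \<comment> \<open>A fixed point stays put, yet \<open>p - i\<close> further steps lead from
      \<open>y\<close> back to \<open>x\<close>.\<close>
    have fix_Orb: "f y \<noteq> y" if y: "y \<in> Orb" for y
    proof
      assume fy: "f y = y"
      obtain i where i: "i < p" "y = (f ^^ i) x" using y unfolding Orb_eq by auto
      have stay: "(f ^^ k) y = y" for k using fy by (induction k) auto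
      have "x = (f ^^ (p - i + i)) x" using i psubset.prems(2)[OF x(1)] by simp
      also have "\<dots> = y" by (simp only: funpow_add o_apply i(2)[symmetric] stay)
      finally show False using x(2) fy by simp
    qed
    have IH: "[card (S - Orb) = card {y \<in> S - Orb. f y = y}] (mod p)"
    proof (rule psubset.IH)
      show "S - Orb \<subset> S" using x Orb_sub unfolding Orb_def by (auto intro!: image_eqI[of _ _ 0])
      show "f ` (S - Orb) \<subseteq> S - Orb" using pre psubset.prems(1) by auto
    qed (use psubset.prems in auto)
    have "{y \<in> S - Orb. f y = y} = {y \<in> S. f y = y}" using fix_Orb by auto
    moreover have "card S = card (S - Orb) + p"
      using card_Orb Orb_sub psubset.hyps p0
      by (metis card_Diff_subset card_mono finite_subset le_add_diff_inverse2)
    ultimately show ?thesis using IH by (simp add: cong_def)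
  qed
qed

section \<open>Coefficients of group ring products as numbers of lists\<close>

text \<open>The endpoint in \<open>D\<close> is determined by the list and \<open>u\<close>, so it
  is not recorded. The lists correspond to the ways of writing \<open>inv u\<close> as a product of
  \<open>k\<close> elements of \<open>D\<close> and the inverse of one more; rotation acts on the
  first \<open>k\<close> factors only.\<close>

definition walks :: "('a, 'c) monoid_scheme \<Rightarrow> 'a set \<Rightarrow> nat \<Rightarrow> 'a \<Rightarrow> 'a list set" where
  "walks G D k u = {xs. length xs = k \<and> set xs \<subseteq> D \<and> foldr (\<otimes>\<^bsub>G\<^esub>) xs u \<in> D}"

context comm_group
begin

text \<open>Closure is part of the induction because \<open>m_lcomm\<close> requires it.\<close>

lemma foldr_mult_left:
  "set xs \<subseteq> carrier G \<Longrightarrow> x \<in> carrier G \<Longrightarrow> u \<in> carrier G \<Longrightarrow>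
    foldr (\<otimes>) xs (x \<otimes> u) = x \<otimes> foldr (\<otimes>) xs u \<and> foldr (\<otimes>) xs u \<in> carrier G"
  by (induction xs) (auto simp: m_lcomm)

lemma foldr_mult_rotate1:
  assumes "set xs \<subseteq> carrier G" "u \<in> carrier G"
  shows "foldr (\<otimes>) (rotate1 xs) u = foldr (\<otimes>) xs u"
  using assms by (cases xs) (auto simp: foldr_mult_left)

lemma foldr_mult_replicate:
  assumes "d \<in> carrier G" "u \<in> carrier G"
  shows "foldr (\<otimes>) (replicate k d) u = d [^] k \<otimes> u"
  using assms by (induction k) (auto simp: m_ac)

lemma finite_walks: "finite D \<Longrightarrow> finite (walks G D k u)"
  by (rule finite_subset[OF _ finite_lists_length_eq[of D k]]) (auto simp: walks_def)

text \<open>Multiplication by \<open>D\<close> in the group ring: by commutativity the first entry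
  \<open>d\<close> can be absorbed into the starting point.\<close>

lemma card_walks_Suc:
  assumes "finite D" "D \<subseteq> carrier G" "u \<in> carrier G"
  shows "card (walks G D (Suc k) u) = (\<Sum>d\<in>D. card (walks G D k (d \<otimes> u)))"
proof -
  have "walks G D (Suc k) u = (\<Union>d\<in>D. (#) d ` walks G D k (d \<otimes> u))"
  proof (rule Set.set_eqI)
    fix xs
    show "xs \<in> walks G D (Suc k) u \<longleftrightarrow> xs \<in> (\<Union>d\<in>D. (#) d ` walks G D k (d \<otimes> u))"
    proof (cases xs)
      case Nil
      then show ?thesis by (auto simp: walks_def)
    next
      case (Cons x ys)
      have "foldr (\<otimes>) ys (x \<otimes> u) = x \<otimes> foldr (\<otimes>) ys u" if "x \<in> D" "set ys \<subseteq> D"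
        using that assms by (intro foldr_mult_left[THEN conjunct1]) auto
      then show ?thesis using Cons by (auto simp: walks_def image_iff)
    qed
  qed
  also have "card \<dots> = (\<Sum>d\<in>D. card ((#) d ` walks G D k (d \<otimes> u)))"
    using assms(1) by (intro card_UN_disjoint) (auto simp: finite_walks)
  also have "\<dots> = (\<Sum>d\<in>D. card (walks G D k (d \<otimes> u)))"
    by (intro sum.cong refl card_image) simp
  finally show ?thesis .
qed

text \<open>This is \<open>D\<^sup>p \<equiv> \<Sum>d\<in>D. d\<^sup>p\<close> in the group ring modulo \<open>p\<close>, multiplied by
  \<open>D\<inverse>\<close>: a list fixed by rotation is constant.\<close>

lemma card_walks_prime:
  assumes p: "Factorial_Ring.prime (p::nat)"
    and D: "finite D" "D \<subseteq> carrier G" and u: "u \<in> carrier G"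
  shows "[card (walks G D p u) = card {d \<in> D. d [^] p \<otimes> u \<in> D}] (mod p)"
proof -
  have p0: "p > 0" using p prime_gt_0_nat by blast
  have "[card (walks G D p u) = card {xs \<in> walks G D p u. rotate1 xs = xs}] (mod p)"
  proof (rule card_fixpoints_cong_prime[OF p finite_walks[OF D(1)]])
    show "rotate1 ` walks G D p u \<subseteq> walks G D p u"
    proof safe
      fix xs assume "xs \<in> walks G D p u"
      moreover from this have "foldr (\<otimes>) (rotate1 xs) u = foldr (\<otimes>) xs u"
        using D(2) u by (intro foldr_mult_rotate1) (auto simp: walks_def)
      ultimately show "rotate1 xs \<in> walks G D p u" by (simp add: walks_def)
    qed
    show "(rotate1 ^^ p) xs = xs" if "xs \<in> walks G D p u" for xs
      using rotate_id[of p xs] that by (simp add: walks_def rotate_def)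
  qed
  also have "{xs \<in> walks G D p u. rotate1 xs = xs}
      = replicate p ` {d \<in> D. d [^] p \<otimes> u \<in> D}" (is "?L = ?R")
  proof (intro equalityI subsetI)
    fix xs assume xs: "xs \<in> ?L"
    then have len: "length xs = p" and "set xs \<subseteq> D" and "foldr (\<otimes>) xs u \<in> D"
      by (auto simp: walks_def)
    moreover obtain d where "set xs = {d}"
      using rotate1_fixpoint_card[of xs] xs len p0 by (auto simp: card_1_singleton_iff)
    then have "xs = replicate p d"
      using len by (metis replicate_eqI singletonD)
    ultimately show "xs \<in> ?R"
      using foldr_mult_replicate[of d u p] D(2) u p0 by auto
  next
    fix xs assume "xs \<in> ?R"
    then show "xs \<in> ?L"
      using foldr_mult_replicate[OF _ u] D(2) by (auto simp: walks_def)
  qed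
  also have "card (replicate p ` {d \<in> D. d [^] p \<otimes> u \<in> D}) = card {d \<in> D. d [^] p \<otimes> u \<in> D}"
    using p0 by (intro card_image inj_onI) (auto simp: replicate_eq_replicate)
  finally show ?thesis .
qed

end

section \<open>Groups of prime exponent\<close>

context comm_group
begin

text \<open>Linear algebra over the field with \<open>p\<close> elements: a vector outside the span
  enlarges an independent family. The new coordinate \<open>f m\<close> becomes the exponent of
  \<open>x\<close>.\<close>

lemma hom_extend_prime_power:
  assumes p: "Factorial_Ring.prime (p::nat)" and exp: "\<And>x. x \<in> carrier G \<Longrightarrow> x [^] p = \<one>"
    and h: "h \<in> hom (product_group {..<m} (\<lambda>_. integer_mod_group p)) G"
      "inj_on h (carrier (product_group {..<m} (\<lambda>_. integer_mod_group p)))"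
    and x: "x \<in> carrier G" "x \<notin> h ` carrier (product_group {..<m} (\<lambda>_. integer_mod_group p))"
  shows "\<exists>h'. h' \<in> hom (product_group {..<Suc m} (\<lambda>_. integer_mod_group p)) G \<and>
    inj_on h' (carrier (product_group {..<Suc m} (\<lambda>_. integer_mod_group p)))"
proof -
  let ?P = "\<lambda>m :: nat. product_group {..<m} (\<lambda>_. integer_mod_group p)"
  have p0: "p > 0" using p prime_gt_0_nat by blast
  interpret h: group_hom "?P m" G h
    using h(1) by (simp add: group_hom_def group_hom_axioms_def)
  \<comment> \<open>The last coordinate is added modulo \<open>p\<close>; this periodicity makes
    \<open>h'\<close> respect that addition.\<close>
  have per: "x [^] (k mod int p) = x [^] k" for k :: int
  proof -
    have "x [^] k = x [^] (int p * (k div int p) + k mod int p)" by simp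
    also have "\<dots> = (x [^] int p) [^] (k div int p) \<otimes> x [^] (k mod int p)"
      using x(1) by (simp only: int_pow_mult int_pow_pow)
    also have "x [^] int p = \<one>" using exp x(1) by (simp add: int_pow_int)
    finally show ?thesis using x(1) by simp
  qed
  let ?r = "\<lambda>f. restrict f {..<m}"
  define h' where "h' = (\<lambda>f. h (?r f) \<otimes> x [^] (f m :: int))"
  have r_in: "?r f \<in> carrier (?P m)" if "f \<in> carrier (?P (Suc m))" for f
    using that by (auto simp: PiE_iff)
  have r_mult: "?r (f \<otimes>\<^bsub>?P (Suc m)\<^esub> g) = ?r f \<otimes>\<^bsub>?P m\<^esub> ?r g" for f g
    by (auto simp: restrict_def)
  have hom': "h' \<in> hom (?P (Suc m)) G"
  proof (rule homI)
    fix f g assume fg: "f \<in> carrier (?P (Suc m))" "g \<in> carrier (?P (Suc m))"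
    have hc: "h (?r f) \<in> carrier G" "h (?r g) \<in> carrier G"
      using h.hom_closed r_in fg by blast+
    have "h' (f \<otimes>\<^bsub>?P (Suc m)\<^esub> g) = h (?r f \<otimes>\<^bsub>?P m\<^esub> ?r g) \<otimes> x [^] ((f m + g m) mod int p)"
      unfolding h'_def r_mult by simp
    also have "h (?r f \<otimes>\<^bsub>?P m\<^esub> ?r g) = h (?r f) \<otimes> h (?r g)"
      using h.hom_mult r_in fg by blast
    finally show "h' (f \<otimes>\<^bsub>?P (Suc m)\<^esub> g) = h' f \<otimes> h' g"
      using hc x(1) by (simp only: per h'_def int_pow_mult) (simp add: m_ac)
  next
    fix f assume "f \<in> carrier (?P (Suc m))"
    then show "h' f \<in> carrier G"
      unfolding h'_def using h.hom_closed r_in x(1) by blast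
  qed
  interpret h': group_hom "?P (Suc m)" G h'
    using hom' by (simp add: group_hom_def group_hom_axioms_def)
  have "inj_on h' (carrier (?P (Suc m)))"
  proof (rule h'.inj_iff_trivial_ker[THEN iffD2], intro equalityI subsetI)
    fix f assume "f \<in> kernel (?P (Suc m)) G h'"
    then have f: "f \<in> carrier (?P (Suc m))" and "h' f = \<one>" by (auto simp: kernel_def)
    then have eq: "h (?r f) \<otimes> x [^] f m = \<one>" by (simp add: h'_def)
    have fm: "0 \<le> f m" "f m < int p"
      using f p0 by (auto simp: PiE_iff carrier_integer_mod_group)
    have inv: "inv (h (?r f)) = x [^] f m"
      using eq h.hom_closed[OF r_in[OF f]] x(1)
      by (metis int_pow_closed inv_equality m_comm)
    \<comment> \<open>Otherwise \<open>f m\<close> has an inverse \<open>c\<close> modulo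
      \<open>p\<close>, and raising the equation \<open>inv\<close> to the power \<open>c\<close>
      puts \<open>x\<close> into the image of \<open>h\<close>.\<close>
    have "f m = 0"
    proof (rule ccontr)
      assume "f m \<noteq> 0"
      then have "\<not> int p dvd f m" using fm by (auto dest: zdvd_imp_le)
      then have "coprime (f m) (int p)"
        using p by (simp add: coprime_commute prime_imp_coprime_int)
      then obtain c where "[f m * c = 1] (mod int p)"
        using cong_solve_coprime_int by blast
      then have "x [^] (f m * c) = x [^] (1::int)"
        using per by (metis cong_def)
      then have "x = (x [^] f m) [^] c"
        using x(1) by (simp add: int_pow_pow)
      also have "\<dots> = h ((inv\<^bsub>?P m\<^esub> (?r f)) [^]\<^bsub>?P m\<^esub> c)"
        using h.hom_int_pow[OF h.G.inv_closed[OF r_in[OF f]], of c] h.hom_inv[OF r_in[OF f]]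
        by (simp add: inv del: inv_product_group)
      finally show False
        using x(2) h.G.int_pow_closed[OF h.G.inv_closed[OF r_in[OF f]], of c] by blast
    qed
    then have "h (?r f) = \<one>" using eq h.hom_closed[OF r_in[OF f]] by simp
    then have "?r f = \<one>\<^bsub>?P m\<^esub>"
      using h(2) r_in[OF f] h.G.one_closed h.hom_one by (metis inj_onD)
    then have "f i = 0" if "i < Suc m" for i
      using that \<open>f m = 0\<close> by (cases "i = m") (auto simp: restrict_def fun_eq_iff split: if_splits)
    then have "f = \<one>\<^bsub>?P (Suc m)\<^esub>"
      using f by (auto simp: PiE_iff extensional_def)
    then show "f \<in> {\<one>\<^bsub>?P (Suc m)\<^esub>}" by simp
  next
    fix f assume "f \<in> {\<one>\<^bsub>?P (Suc m)\<^esub>}"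
    then show "f \<in> kernel (?P (Suc m)) G h'"
      using h'.hom_one h'.G.one_closed
      by (simp add: kernel_def del: one_product_group carrier_product_group)
  qed
  then show ?thesis using hom' by blast
qed

text \<open>The order of \<open>G\<close> bounds the exponents \<open>m\<close> for which the direct
  power embeds. An embedding with the largest \<open>m\<close> is onto, since
  \<open>hom_extend_prime_power\<close> would otherwise enlarge it.\<close>

lemma elementary_abelian_if_prime_exponent:
  assumes fin: "finite (carrier G)"
    and p: "Factorial_Ring.prime (p::nat)" and exp: "\<And>x. x \<in> carrier G \<Longrightarrow> x [^] p = \<one>"
  shows "elementary_abelian G"
proof -
  let ?P = "\<lambda>m :: nat. product_group {..<m} (\<lambda>_. integer_mod_group p)"
  define Q where "Q (m :: nat) \<longleftrightarrow> (\<exists>h. h \<in> hom (?P m) G \<and> inj_on h (carrier (?P m)))" for m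
  have card_P: "card (carrier (?P m)) = p ^ m" for m
    using prime_gt_0_nat[OF p] by (simp add: card_PiE carrier_integer_mod_group)
  have bound: "m < card (carrier G)" if Q: "Q m" for m
  proof -
    obtain h where h: "h \<in> hom (?P m) G" "inj_on h (carrier (?P m))"
      using Q unfolding Q_def by blast
    have "p ^ m \<le> card (carrier G)"
      using card_inj_on_le[OF h(2) hom_carrier[OF h(1)] fin] by (simp only: card_P)
    moreover have "2 ^ m \<le> p ^ m" using prime_ge_2_nat[OF p] by (intro power_mono) auto
    ultimately show ?thesis using less_exp[of m] by linarith
  qed
  \<comment> \<open>The empty product has one element, so even a constant map is injective on
    it.\<close>
  have Q0: "Q 0"
    unfolding Q_def by (rule exI[of _ "\<lambda>_. \<one>"]) (auto simp: hom_def)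
  obtain m where m: "Q m" "\<And>k. Q k \<Longrightarrow> k \<le> m"
    using Q0 bound by (metis GreatestI_nat Greatest_le_nat less_imp_le)
  then obtain h where h: "h \<in> hom (?P m) G" "inj_on h (carrier (?P m))"
    using Q_def by blast
  have "\<not> Q (Suc m)" using m(2)[of "Suc m"] by auto
  then have "carrier G \<subseteq> h ` carrier (?P m)"
    using hom_extend_prime_power[OF p exp h] unfolding Q_def by blast
  then have "h ` carrier (?P m) = carrier G" using h(1) by (auto simp: hom_def)
  then have "h \<in> iso (?P m) G" using h by (simp add: iso_def bij_betw_def)
  then have "?P m \<cong> G" by (auto simp: is_iso_def)
  then have "G \<cong> ?P m" by (simp add: group.iso_sym)
  then show ?thesis unfolding elementary_abelian_def using p by blast
qed

end

section \<open>Circular Costas maps missing only the identity\<close>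

text \<open>\<open>image_eq\<close> carries both the normalization and the relation between the
  group orders, which \<open>card_B\<close> recovers.\<close>

locale normalized_costas = A: comm_group A + B: comm_group B
  for A :: "('a, 'c) monoid_scheme" and B :: "('b, 'd) monoid_scheme" +
  fixes \<phi> :: "'a \<Rightarrow> 'b"
  assumes finite_A: "finite (carrier A)"
    and costas: "circular_costas A B \<phi>"
    and image_eq: "\<phi> ` carrier A = carrier B - {\<one>\<^bsub>B\<^esub>}"
begin

sublocale AB: comm_group "A \<times>\<times> B"
proof -
  interpret AB: group "A \<times>\<times> B"
    by (rule DirProd_group) (rule A.group_axioms B.group_axioms)+
  show "comm_group (A \<times>\<times> B)"
    by (rule AB.group_comm_groupI) (auto simp: DirProd_def A.m_comm B.m_comm)
qed

definition D where "D = (\<lambda>i. (i, \<phi> i)) ` carrier A"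

abbreviation W where "W k a b \<equiv> int (card (walks (A \<times>\<times> B) D k (a, b)))"

lemma closed: "i \<in> carrier A \<Longrightarrow> \<phi> i \<in> carrier B"
  and ne_one: "i \<in> carrier A \<Longrightarrow> \<phi> i \<noteq> \<one>\<^bsub>B\<^esub>"
  and inj: "inj_on \<phi> (carrier A)"
  using image_eq costas by (auto simp: circular_costas_def)

lemma card_B: "card (carrier B) = card (carrier A) + 1"
proof -
  have "finite (carrier B - {\<one>\<^bsub>B\<^esub>})" using image_eq finite_A by (metis finite_imageI)
  then have "finite (carrier B)" by simp
  have "card (carrier A) = card (carrier B - {\<one>\<^bsub>B\<^esub>})"
    using image_eq inj by (metis card_image)
  then show ?thesis
    using card_Suc_Diff1[OF \<open>finite (carrier B)\<close> B.one_closed] by simp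
qed

lemma D_sub: "D \<subseteq> carrier (A \<times>\<times> B)" "finite D"
  using closed finite_A by (auto simp: D_def DirProd_def)

lemma in_D_iff: "(a, b) \<in> D \<longleftrightarrow> a \<in> carrier A \<and> b = \<phi> a"
  by (auto simp: D_def)

section \<open>Coefficients for the graph, first exact and then modulo \<open>p\<close>\<close>

lemma W_Suc:
  assumes "a \<in> carrier A" "b \<in> carrier B"
  shows "W (Suc k) a b = (\<Sum>i\<in>carrier A. W k (i \<otimes>\<^bsub>A\<^esub> a) (\<phi> i \<otimes>\<^bsub>B\<^esub> b))"
proof -
  have "card (walks (A \<times>\<times> B) D (Suc k) (a, b)) =
      (\<Sum>d\<in>D. card (walks (A \<times>\<times> B) D k (d \<otimes>\<^bsub>A \<times>\<times> B\<^esub> (a, b))))"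
    using assms by (intro AB.card_walks_Suc D_sub) (auto simp: DirProd_def)
  also have "\<dots> = (\<Sum>i\<in>carrier A. card (walks (A \<times>\<times> B) D k (i \<otimes>\<^bsub>A\<^esub> a, \<phi> i \<otimes>\<^bsub>B\<^esub> b)))"
    unfolding D_def by (subst sum.reindex) (auto simp: inj_on_def)
  finally show ?thesis by simp
qed

lemma W_0: "W 0 a b = of_bool (a \<in> carrier A \<and> b = \<phi> a)"
proof -
  have "walks (A \<times>\<times> B) D 0 (a, b) = (if (a, b) \<in> D then {[]} else {})"
    by (auto simp: walks_def)
  then show ?thesis by (simp add: in_D_iff)
qed

lemma sum_of_bool_eq_1:
  assumes "finite S" "x \<in> S" "\<And>i. i \<in> S \<Longrightarrow> P i \<longleftrightarrow> i = x"
  shows "(\<Sum>i\<in>S. of_bool (P i)) = (1::int)"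
proof -
  have "(\<Sum>i\<in>S. of_bool (P i)) = (\<Sum>i\<in>S. if i = x then 1 else (0::int))"
    using assms by (intro sum.cong) auto
  then show ?thesis using assms by simp
qed

text \<open>\<open>W k a b\<close> is the coefficient of \<open>(a, b)\<inverse>\<close> in \<open>D\<^sup>k D\<inverse>\<close>.\<close>

lemma W_1:
  assumes a: "a \<in> carrier A" and b: "b \<in> carrier B"
  shows "W 1 a b = int (card (carrier B)) * of_bool (a = \<one>\<^bsub>A\<^esub> \<and> b = \<one>\<^bsub>B\<^esub>)
    + 1 - of_bool (a = \<one>\<^bsub>A\<^esub>) - of_bool (b = \<one>\<^bsub>B\<^esub>)"
proof -
  have "W 1 a b = (\<Sum>i\<in>carrier A. of_bool (\<phi> i \<otimes>\<^bsub>B\<^esub> b = \<phi> (i \<otimes>\<^bsub>A\<^esub> a)))"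
    using W_Suc[OF a b, of 0] a by (auto simp: W_0 intro!: sum.cong)
  \<comment> \<open>Solving for \<open>b\<close> turns the count into the number of times the
    difference map with shift \<open>a\<close> takes the value \<open>b\<close>.\<close>
  also have "\<dots> = (\<Sum>i\<in>carrier A. of_bool (\<phi> (i \<otimes>\<^bsub>A\<^esub> a) \<otimes>\<^bsub>B\<^esub> inv\<^bsub>B\<^esub> (\<phi> i) = b))"
    (is "_ = (\<Sum>i\<in>_. of_bool (?f i = b))")
    using a b closed
    by (intro sum.cong refl arg_cong[of _ _ of_bool])
       (metis A.m_closed B.inv_solve_right' B.m_comm)
  finally have W: "W 1 a b = (\<Sum>i\<in>carrier A. of_bool (?f i = b))" .
  show ?thesis
  proof (cases "a = \<one>\<^bsub>A\<^esub>")
    case True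
    \<comment> \<open>Without a shift all differences are the identity, so the count at
      \<open>b = 1\<close> is the order of \<open>A\<close>, one less than that of
      \<open>B\<close>.\<close>
    then have "W 1 a b = (\<Sum>i\<in>carrier A. of_bool (\<one>\<^bsub>B\<^esub> = b))"
      unfolding W using closed by (intro sum.cong) auto
    then show ?thesis using True card_B by auto
  next
    case False
    have inj_f: "inj_on ?f (carrier A)"
      using costas a False by (auto simp: circular_costas_def)
    have f_ne: "?f i \<noteq> \<one>\<^bsub>B\<^esub>" if "i \<in> carrier A" for i
    proof
      assume "?f i = \<one>\<^bsub>B\<^esub>"
      then have "\<phi> (i \<otimes>\<^bsub>A\<^esub> a) = \<phi> i"
        using that a closed by (metis A.m_closed B.inv_solve_right' B.l_one B.one_closed)
      then have "i \<otimes>\<^bsub>A\<^esub> a = i" using inj that a by (meson A.m_closed inj_onD)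
      then show False using False that a by simp
    qed
    \<comment> \<open>The Costas property enters here: an injective map avoiding the identity takes
      as many values as there are other elements, so it takes each of them exactly once.\<close>
    have "?f ` carrier A = carrier B - {\<one>\<^bsub>B\<^esub>}"
    proof (rule card_subset_eq)
      show fin: "finite (carrier B - {\<one>\<^bsub>B\<^esub>})"
        using image_eq finite_A by (metis finite_imageI)
      show "?f ` carrier A \<subseteq> carrier B - {\<one>\<^bsub>B\<^esub>}" using f_ne closed a by auto
      show "card (?f ` carrier A) = card (carrier B - {\<one>\<^bsub>B\<^esub>})"
        using card_image[OF inj_f] card_image[OF inj] image_eq by simp
    qed
    then show ?thesis
    proof (cases "b = \<one>\<^bsub>B\<^esub>")
      case True
      then show ?thesis unfolding W using False f_ne by (auto intro!: sum.neutral)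
    next
      case bne: False
      then have "b \<in> ?f ` carrier A" using b \<open>?f ` _ = _\<close> by blast
      then obtain x where x: "x \<in> carrier A" "?f x = b" by blast
      then have "W 1 a b = 1"
        unfolding W using inj_f finite_A by (intro sum_of_bool_eq_1) (auto dest: inj_onD)
      then show ?thesis using False bne by simp
    qed
  qed
qed

text \<open>The relation \<open>D B = G\<close>, with \<open>B\<close> the sum over the second
  factor: the graph has one point above each element of \<open>A\<close>.\<close>

lemma sum_mult_eq_one_A:
  assumes "a \<in> carrier A"
  shows "(\<Sum>i\<in>carrier A. of_bool (i \<otimes>\<^bsub>A\<^esub> a = \<one>\<^bsub>A\<^esub>)) = (1::int)"
  using assms finite_A
  by (intro sum_of_bool_eq_1[of _ "inv\<^bsub>A\<^esub> a"]) (auto simp: A.inv_equality)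

text \<open>The relation \<open>D A = G - A\<close>, with \<open>A\<close> the sum over the first
  factor: \<phi> takes each value other than the identity once.\<close>

lemma sum_mult_eq_one_B:
  assumes "b \<in> carrier B"
  shows "(\<Sum>i\<in>carrier A. of_bool (\<phi> i \<otimes>\<^bsub>B\<^esub> b = \<one>\<^bsub>B\<^esub>)) = (1 - of_bool (b = \<one>\<^bsub>B\<^esub>) :: int)"
proof (cases "b = \<one>\<^bsub>B\<^esub>")
  case True
  then show ?thesis using closed ne_one by (auto intro!: sum.neutral)
next
  case False
  then have "inv\<^bsub>B\<^esub> b \<in> \<phi> ` carrier A"
    using image_eq assms by (auto simp: B.inv_eq_1_iff)
  then obtain x where x: "x \<in> carrier A" "\<phi> x = inv\<^bsub>B\<^esub> b" by auto
  have "(\<Sum>i\<in>carrier A. of_bool (\<phi> i \<otimes>\<^bsub>B\<^esub> b = \<one>\<^bsub>B\<^esub>)) = (1::int)"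
  proof (rule sum_of_bool_eq_1[OF finite_A x(1)])
    fix i assume i: "i \<in> carrier A"
    have "\<phi> i \<otimes>\<^bsub>B\<^esub> b = \<one>\<^bsub>B\<^esub> \<longleftrightarrow> \<phi> i = \<phi> x"
      using x i closed assms B.inv_equality B.l_inv by auto
    then show "\<phi> i \<otimes>\<^bsub>B\<^esub> b = \<one>\<^bsub>B\<^esub> \<longleftrightarrow> i = x" using inj i x(1) by (auto dest: inj_onD)
  qed
  then show ?thesis using False by simp
qed

text \<open>Let \<open>G\<close>, \<open>A\<close>, \<open>B\<close> be the sums over the product
  and its two factors. Modulo \<open>p\<close> the term \<open>n D\<close> vanishes and
  \<open>D G = -G\<close>, as the order of the first group is \<open>-1\<close>. With
  \<open>D A = G - A\<close> and \<open>D B = G\<close> this gives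
  \<open>D^(k+2) D^-1 = (-1)^(k+1) ((k+3) G - A)\<close>. The shift by \<open>2\<close> is there
  because the coefficients no longer depend on \<open>a\<close> from the second power on.\<close>

lemma W_cong:
  assumes p: "p dvd card (carrier B)" and ab: "a \<in> carrier A" "b \<in> carrier B"
  shows "[W (k + 2) a b = (-1) ^ (k + 1) * (int k + 3 - of_bool (b = \<one>\<^bsub>B\<^esub>))] (mod int p)"
  using ab
proof (induction k arbitrary: a b)
  have "[int (card (carrier B)) = 0] (mod int p)" using p by (simp add: cong_0_iff)
  then have nA: "[int (card (carrier A)) = -1] (mod int p)"
    using card_B by (simp add: cong_iff_dvd_diff add.commute)
  {
    case 0
    have "W (0 + 2) a b = (\<Sum>i\<in>carrier A. W 1 (i \<otimes>\<^bsub>A\<^esub> a) (\<phi> i \<otimes>\<^bsub>B\<^esub> b))"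
      using W_Suc[OF 0, of 1] by (simp add: numeral_2_eq_2)
    also have "[\<dots> = (\<Sum>i\<in>carrier A. 1 - of_bool (i \<otimes>\<^bsub>A\<^esub> a = \<one>\<^bsub>A\<^esub>)
        - of_bool (\<phi> i \<otimes>\<^bsub>B\<^esub> b = \<one>\<^bsub>B\<^esub>))] (mod int p)"
    proof (rule cong_sum)
      fix i assume "i \<in> carrier A"
      then show "[W 1 (i \<otimes>\<^bsub>A\<^esub> a) (\<phi> i \<otimes>\<^bsub>B\<^esub> b) = 1 - of_bool (i \<otimes>\<^bsub>A\<^esub> a = \<one>\<^bsub>A\<^esub>)
          - of_bool (\<phi> i \<otimes>\<^bsub>B\<^esub> b = \<one>\<^bsub>B\<^esub>)] (mod int p)"
        using p 0 closed by (subst W_1) (auto simp: cong_iff_dvd_diff)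
    qed
    also have "(\<Sum>i\<in>carrier A. 1 - of_bool (i \<otimes>\<^bsub>A\<^esub> a = \<one>\<^bsub>A\<^esub>)
        - of_bool (\<phi> i \<otimes>\<^bsub>B\<^esub> b = \<one>\<^bsub>B\<^esub>)) =
        int (card (carrier A)) - 2 + of_bool (b = \<one>\<^bsub>B\<^esub>)"
      using 0 by (simp add: sum_subtractf sum_mult_eq_one_A sum_mult_eq_one_B del: sum_of_bool_eq)
    also have "[\<dots> = -1 - 2 + of_bool (b = \<one>\<^bsub>B\<^esub>)] (mod int p)"
      by (intro cong_add cong_diff nA cong_refl)
    finally show ?case by simp
  next
    case (Suc k)
    let ?c = "(-1) ^ (k + 1) :: int"
    have "W (Suc k + 2) a b = (\<Sum>i\<in>carrier A. W (k + 2) (i \<otimes>\<^bsub>A\<^esub> a) (\<phi> i \<otimes>\<^bsub>B\<^esub> b))"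
      using W_Suc[OF Suc.prems, of "k + 2"] by simp
    also have "[\<dots> = (\<Sum>i\<in>carrier A. ?c * (int k + 3 - of_bool (\<phi> i \<otimes>\<^bsub>B\<^esub> b = \<one>\<^bsub>B\<^esub>)))] (mod int p)"
      using Suc closed by (intro cong_sum Suc.IH) auto
    also have "(\<Sum>i\<in>carrier A. ?c * (int k + 3 - of_bool (\<phi> i \<otimes>\<^bsub>B\<^esub> b = \<one>\<^bsub>B\<^esub>)))
        = ?c * (int (card (carrier A)) * (int k + 3) - (1 - of_bool (b = \<one>\<^bsub>B\<^esub>)))"
      unfolding sum_distrib_left[symmetric] sum_subtractf sum_mult_eq_one_B[OF Suc.prems(2)] by simp
    also have "[\<dots> = ?c * (-1 * (int k + 3) - (1 - of_bool (b = \<one>\<^bsub>B\<^esub>)))] (mod int p)"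
      by (intro cong_mult cong_diff nA cong_refl)
    finally show ?case by (simp add: algebra_simps)
  }
qed

section \<open>From the congruences to the exponent of \<open>B\<close>\<close>

lemma exists_power_eq:
  assumes p: "Factorial_Ring.prime (p::nat)" "p dvd card (carrier B)"
    and ab: "a \<in> carrier A" "b \<in> carrier B" "b \<noteq> \<one>\<^bsub>B\<^esub>"
  shows "\<exists>i\<in>carrier A. \<phi> i [^]\<^bsub>B\<^esub> p \<otimes>\<^bsub>B\<^esub> b = \<phi> (i [^]\<^bsub>A\<^esub> p \<otimes>\<^bsub>A\<^esub> a)"
proof -
  have p2: "p \<ge> 2" using p(1) by (rule prime_ge_2_nat)
  define k where "k = p - 2"
  have k: "p = k + 2" unfolding k_def using p2 by simp
  have "[W p a b = (-1) ^ (p - 1) * (int p + 1)] (mod int p)"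
    using W_cong[OF p(2) ab(1,2), of k] ab(3) by (simp add: k algebra_simps)
  \<comment> \<open>The sign is \<open>1\<close> for odd \<open>p\<close>; for \<open>p = 2\<close>
    it is \<open>-1\<close>, which agrees with \<open>1\<close> modulo \<open>2\<close>.\<close>
  moreover have "[(-1) ^ (p - 1) * (int p + 1) = 1] (mod int p)"
  proof (cases "p = 2")
    case True
    then show ?thesis by (simp add: cong_def)
  next
    case False
    then have "even (p - 1)"
      using p(1) p2 prime_odd_nat[of p] by auto
    then show ?thesis by (simp add: cong_def)
  qed
  moreover have "[W p a b = int (card {d \<in> D. d [^]\<^bsub>A \<times>\<times> B\<^esub> p \<otimes>\<^bsub>A \<times>\<times> B\<^esub> (a, b) \<in> D})] (mod int p)"
    using AB.card_walks_prime[OF p(1) D_sub(2,1), of "(a, b)"] ab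
    by (simp add: cong_int_iff DirProd_def)
  ultimately have "[int (card {d \<in> D. d [^]\<^bsub>A \<times>\<times> B\<^esub> p \<otimes>\<^bsub>A \<times>\<times> B\<^esub> (a, b) \<in> D}) = 1] (mod int p)"
    by (meson cong_sym cong_trans)
  \<comment> \<open>A number of solutions congruent to \<open>1\<close> modulo \<open>p\<close>
    cannot be zero.\<close>
  moreover have "\<not> [int 0 = 1] (mod int p)"
    using p2 by (simp add: cong_def)
  ultimately have "{d \<in> D. d [^]\<^bsub>A \<times>\<times> B\<^esub> p \<otimes>\<^bsub>A \<times>\<times> B\<^esub> (a, b) \<in> D} \<noteq> {}"
    by (metis card.empty)
  moreover have "(i, \<phi> i) [^]\<^bsub>A \<times>\<times> B\<^esub> p = (i [^]\<^bsub>A\<^esub> p, \<phi> i [^]\<^bsub>B\<^esub> p)" for i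
    by (induction p) (auto simp: DirProd_def nat_pow_def)
  ultimately show ?thesis by (auto simp: D_def)
qed

lemma power_prime_eq_one:
  assumes p: "Factorial_Ring.prime (p::nat)" "p dvd card (carrier B)" and x: "x \<in> carrier B"
  shows "x [^]\<^bsub>B\<^esub> p = \<one>\<^bsub>B\<^esub>"
proof (rule ccontr)
  assume ne: "x [^]\<^bsub>B\<^esub> p \<noteq> \<one>\<^bsub>B\<^esub>"
  then have "x \<noteq> \<one>\<^bsub>B\<^esub>" by auto
  then obtain i where i: "i \<in> carrier A" "x = \<phi> i" using x image_eq by auto
  \<comment> \<open>With this \<open>b\<close> the left side of \<open>exists_power_eq\<close> at
    the solution \<open>i\<close> is the identity, which \<phi> never attains.\<close>
  define b where "b = inv\<^bsub>B\<^esub> (x [^]\<^bsub>B\<^esub> p)"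
  have b: "b \<in> carrier B" "b \<noteq> \<one>\<^bsub>B\<^esub>"
    unfolding b_def using x ne by (auto simp: B.inv_eq_1_iff)
  obtain j where j: "\<And>a. a \<in> carrier A \<Longrightarrow> j a \<in> carrier A"
      "\<And>a. a \<in> carrier A \<Longrightarrow>
        \<phi> (j a) [^]\<^bsub>B\<^esub> p \<otimes>\<^bsub>B\<^esub> b = \<phi> (j a [^]\<^bsub>A\<^esub> p \<otimes>\<^bsub>A\<^esub> a)"
    using exists_power_eq[OF p _ b] by metis
  \<comment> \<open>By injectivity of \<phi> and cancellation a solution determines
    \<open>a\<close>. As an injective self-map of a finite set, \<open>j\<close> is then onto, so
    the given \<open>i\<close> is among the chosen solutions.\<close>
  have "inj_on j (carrier A)"
  proof (rule inj_onI)
    fix a a' assume a: "a \<in> carrier A" "a' \<in> carrier A" "j a = j a'"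
    then have "\<phi> (j a [^]\<^bsub>A\<^esub> p \<otimes>\<^bsub>A\<^esub> a) = \<phi> (j a [^]\<^bsub>A\<^esub> p \<otimes>\<^bsub>A\<^esub> a')"
      using j(2)[of a] j(2)[of a'] by simp
    then have "j a [^]\<^bsub>A\<^esub> p \<otimes>\<^bsub>A\<^esub> a = j a [^]\<^bsub>A\<^esub> p \<otimes>\<^bsub>A\<^esub> a'"
      by (rule inj_onD[OF inj]) (use a(1,2) j(1) in \<open>blast intro: A.m_closed A.nat_pow_closed\<close>)+
    then show "a = a'"
      using A.Units_l_cancel[of "j a [^]\<^bsub>A\<^esub> p"] A.nat_pow_closed[OF j(1)[OF a(1)], of p] a(1,2)
      unfolding A.Units_eq by blast
  qed
  moreover have "j ` carrier A \<subseteq> carrier A" using j(1) by blast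
  ultimately have "j ` carrier A = carrier A"
    using finite_A by (intro endo_inj_surj)
  then obtain a where a: "a \<in> carrier A" "j a = i" using i(1) by (metis imageE)
  then have "\<phi> (i [^]\<^bsub>A\<^esub> p \<otimes>\<^bsub>A\<^esub> a) = \<one>\<^bsub>B\<^esub>"
    using j(2)[of a] i x by (simp add: b_def)
  then show False using ne_one a i by auto
qed

end

section \<open>Reduction to maps missing only the identity\<close>

lemma (in group) circular_costas_translate:
  assumes H: "comm_group H" and c: "circular_costas G H \<phi>" and t: "t \<in> carrier H"
  shows "circular_costas G H (\<lambda>i. \<phi> i \<otimes>\<^bsub>H\<^esub> t)"
proof -
  interpret H: comm_group H by (rule H)
  have cl: "\<phi> i \<in> carrier H" if "i \<in> carrier G" for i
    using c that by (auto simp: circular_costas_def)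
  \<comment> \<open>Inverting the product puts \<open>t\<close> next to its inverse, and the
    reversed associativity law for \<open>t\<close> lets them cancel.\<close>
  have "\<phi> (i \<otimes> k) \<otimes>\<^bsub>H\<^esub> t \<otimes>\<^bsub>H\<^esub> inv\<^bsub>H\<^esub> (\<phi> i \<otimes>\<^bsub>H\<^esub> t)
      = \<phi> (i \<otimes> k) \<otimes>\<^bsub>H\<^esub> inv\<^bsub>H\<^esub> (\<phi> i)" if "i \<in> carrier G" "k \<in> carrier G" for i k
    using that t cl[of i] cl[of "i \<otimes> k"]
    by (simp add: H.inv_mult_group H.m_assoc H.m_assoc[symmetric, of t])
  moreover have "inj_on (\<lambda>i. \<phi> i \<otimes>\<^bsub>H\<^esub> t) (carrier G)"
    using c t cl by (auto simp: circular_costas_def inj_on_def)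
  ultimately show ?thesis
    using c t by (auto simp: circular_costas_def cong: inj_on_cong)
qed

theorem theorem4p5:
  fixes G1 :: "('a, 'c) monoid_scheme" and G2 :: "('b, 'd) monoid_scheme"
    and \<phi> :: "'a \<Rightarrow> 'b"
  assumes "comm_group G1" and "finite (carrier G1)"
    and "comm_group G2" and "finite (carrier G2)"
    and "card (carrier G1) + 1 = card (carrier G2)"
    and "circular_costas G1 G2 \<phi>"
  shows "elementary_abelian G2"
proof -
  interpret G1: comm_group G1 by fact
  interpret G2: comm_group G2 by fact
  have sub: "\<phi> ` carrier G1 \<subseteq> carrier G2" and inj: "inj_on \<phi> (carrier G1)"
    using assms(6) by (auto simp: circular_costas_def)
  have "card (carrier G2 - \<phi> ` carrier G1) = 1"
    using sub assms(2,5) card_image[OF inj] by (simp add: card_Diff_subset)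
  then obtain c where c: "carrier G2 - \<phi> ` carrier G1 = {c}"
    by (auto simp: card_1_singleton_iff)
  then have cG: "c \<in> carrier G2" "c \<notin> \<phi> ` carrier G1" by auto
  \<comment> \<open>The only missed value \<open>c\<close> is moved to the identity.\<close>
  define \<psi> where "\<psi> i = \<phi> i \<otimes>\<^bsub>G2\<^esub> inv\<^bsub>G2\<^esub> c" for i
  interpret normalized_costas G1 G2 \<psi>
  proof unfold_locales
    show "circular_costas G1 G2 \<psi>"
      unfolding \<psi>_def using assms(3,6) cG(1) by (intro G1.circular_costas_translate) auto
    show "\<psi> ` carrier G1 = carrier G2 - {\<one>\<^bsub>G2\<^esub>}"
    proof (intro equalityI subsetI)
      fix y assume "y \<in> \<psi> ` carrier G1"
      then obtain i where i: "i \<in> carrier G1" "y = \<phi> i \<otimes>\<^bsub>G2\<^esub> inv\<^bsub>G2\<^esub> c"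
        by (auto simp: \<psi>_def)
      then have "\<phi> i \<in> carrier G2" "\<phi> i \<noteq> c" using sub cG by auto
      then show "y \<in> carrier G2 - {\<one>\<^bsub>G2\<^esub>}"
        using i cG by (auto dest: G2.inv_equality)
    next
      fix y assume y: "y \<in> carrier G2 - {\<one>\<^bsub>G2\<^esub>}"
      then have "y \<otimes>\<^bsub>G2\<^esub> c \<in> carrier G2" "y \<otimes>\<^bsub>G2\<^esub> c \<noteq> c" using cG by auto
      then have "y \<otimes>\<^bsub>G2\<^esub> c \<in> \<phi> ` carrier G1" using c by (metis DiffI singletonD)
      then obtain i where i: "i \<in> carrier G1" "\<phi> i = y \<otimes>\<^bsub>G2\<^esub> c" by (metis imageE)
      then have "y = \<psi> i" using y cG by (simp add: \<psi>_def G2.m_assoc)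
      then show "y \<in> \<psi> ` carrier G1" using i(1) by (rule image_eqI)
    qed
  qed fact
  \<comment> \<open>The order of \<open>G2\<close> is therefore at least \<open>2\<close>, so it has
    a prime divisor.\<close>
  have "carrier G1 \<noteq> {}" by auto
  then have "card (carrier G2) \<noteq> 1" using assms(2,5) by auto
  then obtain p where "Factorial_Ring.prime p" "p dvd card (carrier G2)"
    using prime_factor_nat by blast
  then show ?thesis
    using G2.elementary_abelian_if_prime_exponent assms(4) power_prime_eq_one by blast
qed

end
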